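(* Let $\mathbb{F}=\mathbb{R}$ or $\mathbb{F}=\mathbb{C}$, let $A,B\in H_n^+(\mathbb{F})$ and $A\neq 0$. Then $A\leq^- B$ if and only if there exists an invertible matrix $S\in M_n(\mathbb{F})$ such that $$A=S\begin{bmatrix} I_r & 0\\ 0 & 0\end{bmatrix}S^*\quad\text{and}\quad B=S\begin{bmatrix} I_s & 0\\ 0 & 0\end{bmatrix}S^*,$$ where $I_r$ and $I_s$ are the $r\times r$ and $s\times s$ identity matrices, respectively, $s\leq n$, and $r<s$ if $A\neq B$, and $r=s$ otherwise. (When $s=n$, the zero blocks in the formula for $B$ are absent.)
   Context: $M_n(\mathbb{F})$ is the set of $n\times n$ matrices over $\mathbb{F}$, and $A^*$ is the conjugate transpose of $A$ (the transpose $A^t$ when $\mathbb{F}=\mathbb{R}$). $H_n^+(\mathbb{F})$ is the set of positive semidefinite matrices in $M_n(\mathbb{F})$, i.e. matrices $A$ with $A=A^*$ and $z^*Az\geq 0$ for every $z\in\mathbb{F}^n$. An inner generalized inverse of $A$ is any matrix $A^-$ with $AA^-A=A$. The minus partial order is defined by: $A\leq^- B$ when $A^-A=A^-B$ and $AA^-=BA^-$ for some inner generalized inverse $A^-$ of $A$; equivalently, $\operatorname{rank}(B-A)=\operatorname{rank}(B)-\operatorname{rank}(A)$. *)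

theory Defs
  imports "Jordan_Normal_Form.Schur_Decomposition"
begin

(* mat_adjoint is the conjugate transpose, since conjugate is the identity on real.
   The order on complex is the one of HOL-Library.Complex_Order: 0 \<le> w says that
   w is real and nonnegative. *)
definition psd_mats :: "nat \<Rightarrow> 'a :: conjugatable_ordered_field mat set" where
  "psd_mats n = {A \<in> carrier_mat n n. mat_adjoint A = A \<and>
     (\<forall>z \<in> carrier_vec n. conjugate z \<bullet> (A *\<^sub>v z) \<ge> 0)}"

definition inner_ginverse :: "'a :: semiring_0 mat \<Rightarrow> 'a mat \<Rightarrow> bool" where
  "inner_ginverse A X \<longleftrightarrow> X \<in> carrier_mat (dim_col A) (dim_row A) \<and> A * X * A = A"

definition minus_le :: "'a :: semiring_0 mat \<Rightarrow> 'a mat \<Rightarrow> bool" (infix \<open>\<le>\<^sup>-\<close> 50) where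
  "A \<le>\<^sup>- B \<longleftrightarrow> B \<in> carrier_mat (dim_row A) (dim_col A) \<and>
     (\<exists>X. inner_ginverse A X \<and> X * A = X * B \<and> A * X = B * X)"

(* The n x n block matrix diag(I_r, 0); meaningful only for r \<le> n, and for r = n
   the zero blocks are empty. *)
definition id_block_mat :: "nat \<Rightarrow> nat \<Rightarrow> 'a :: {zero, one} mat" where
  "id_block_mat n r = four_block_mat (1\<^sub>m r) (0\<^sub>m r (n - r)) (0\<^sub>m (n - r) r) (0\<^sub>m (n - r) (n - r))"

end

theory Submission
  imports Defs
begin

text \<open>
  Write \<open>C = B - A\<close>. If \<open>X\<close> is an inner inverse of \<open>A\<close> that witnesses \<open>A \<le>\<^sup>- B\<close>, then
  \<open>P = A X\<close> satisfies \<open>P A = A\<close> and \<open>P C = 0\<close>: the ranges of \<open>A\<close> and \<open>C\<close> meet only in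
  zero, and \<open>P\<close> separates them. Moreover \<open>C = (I - P) B (I - P)\<^sup>*\<close>, so \<open>C\<close> is again
  positive semidefinite (\<open>minus_le_imp_ex_projection\<close>). It therefore suffices to bring two
  positive semidefinite matrices separated in this way simultaneously to the forms
  \<open>diag(I\<^sub>r, 0, 0)\<close> and \<open>diag(0, I\<^sub>k, 0)\<close> by a congruence; then \<open>A + C = B\<close> takes the
  form \<open>diag(I\<^sub>s, 0)\<close> with \<open>s = r + k\<close>.

  This is done by induction on the size, one diagonal entry at a time, without any spectral theory
  (\<open>psd_mats_simultaneous_congr\<close>). As long as \<open>A \<noteq> 0\<close>, some \<open>z\<close> has \<open>z\<^sup>* A z > 0\<close>, and
  \<open>w = P\<^sup>* z\<close> has the same value of the form of \<open>A\<close> while \<open>C w = 0\<close>. After scaling,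
  \<open>w\<^sup>* A w = 1\<close>. Making \<open>w\<close> the first vector of a basis turns \<open>A\<close> into a matrix with corner
  entry one and \<open>C\<close> into a matrix whose first row and column vanish; clearing the rest of the first
  row and column of \<open>A\<close> does not disturb \<open>C\<close>. What is left are two smaller positive semidefinite
  matrices, separated by the lower right block of the transformed \<open>P\<close>
  (\<open>ex_split_off_rank_one\<close>). Once \<open>A\<close> is exhausted, the same step, applied to \<open>C\<close> alone,
  diagonalizes the remaining part (\<open>psd_mats_congr_id_block_mat\<close>).

  Conversely, \<open>X = S\<^sup>-\<^sup>* diag(I\<^sub>r, 0) S\<^sup>-\<^sup>1\<close> is an inner inverse of
  \<open>A = S diag(I\<^sub>r, 0) S\<^sup>*\<close>, and it witnesses \<open>A \<le>\<^sup>- B\<close> because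
  \<open>diag(I\<^sub>r, 0) diag(I\<^sub>s, 0) = diag(I\<^sub>r, 0)\<close> for \<open>r \<le> s\<close>
  (\<open>minus_le_congr_id_block_mat\<close>).
\<close>

section \<open>The conjugate transpose\<close>

lemma mat_adjoint_dim [simp]:
  "dim_row (mat_adjoint A) = dim_col A" "dim_col (mat_adjoint A) = dim_row A"
  by (auto simp: mat_adjoint_def mat_of_rows_def)

lemma mat_adjoint_carrier [simp]: "A \<in> carrier_mat m n \<Longrightarrow> mat_adjoint A \<in> carrier_mat n m"
  by (intro carrier_matI) auto

lemma mat_adjoint_index [simp]:
  "i < dim_col A \<Longrightarrow> j < dim_row A \<Longrightarrow> mat_adjoint A $$ (i, j) = conjugate (A $$ (j, i))"
  by (auto simp: mat_adjoint_def mat_of_rows_def)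

lemma mat_adjoint_adjoint [simp]: "mat_adjoint (mat_adjoint A) = A"
  by (rule eq_matI) auto

lemma conjugate_one [simp]: "conjugate (1 :: 'a :: conjugatable_field) = 1"
proof -
  have "conjugate (1 :: 'a) * conjugate 1 = conjugate 1"
    by (metis conjugate_dist_mul mult_1)
  then show ?thesis
    by simp
qed

lemma mat_adjoint_one [simp]: "mat_adjoint (1\<^sub>m n) = (1\<^sub>m n :: 'a :: conjugatable_field mat)"
  by (rule eq_matI) auto

lemma mat_adjoint_zero [simp]:
  "mat_adjoint (0\<^sub>m m n) = (0\<^sub>m n m :: 'a :: conjugatable_field mat)"
  by (rule eq_matI) auto

lemma mat_adjoint_minus:
  assumes "A \<in> carrier_mat m n" "B \<in> carrier_mat m n"
  shows "mat_adjoint (A - B) = mat_adjoint A - mat_adjoint B"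
proof -
  have "conjugate (a - b) = conjugate a - conjugate b" for a b :: 'a
    using conjugate_dist_add[of a "- b"] by (simp add: conjugate_neg)
  then show ?thesis
    by (intro eq_matI) (use assms in auto)
qed

lemma mat_adjoint_mult:
  assumes "A \<in> carrier_mat l m" "B \<in> carrier_mat m n"
  shows "mat_adjoint (A * B) = mat_adjoint B * mat_adjoint A"
  by (rule eq_matI, use assms in
      \<open>auto simp: scalar_prod_def sum_conjugate conjugate_dist_mul mult.commute intro!: sum.cong\<close>)

lemma mat_adjoint_four_block:
  assumes "A \<in> carrier_mat nr1 nc1" "B \<in> carrier_mat nr1 nc2"
    "C \<in> carrier_mat nr2 nc1" "D \<in> carrier_mat nr2 nc2"
  shows "mat_adjoint (four_block_mat A B C D) =
    four_block_mat (mat_adjoint A) (mat_adjoint C) (mat_adjoint B) (mat_adjoint D)"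
  by (rule eq_matI, use assms in auto)

lemma scalar_prod_adjoint:
  assumes "T \<in> carrier_mat m n" "x \<in> carrier_vec n" "y \<in> carrier_vec m"
  shows "conjugate x \<bullet> (mat_adjoint T *\<^sub>v y) = conjugate (T *\<^sub>v x) \<bullet> y"
proof -
  have "conjugate x \<bullet> (mat_adjoint T *\<^sub>v y) =
      (\<Sum>i<n. \<Sum>j<m. conjugate (x $ i) * conjugate (T $$ (j, i)) * y $ j)"
    using assms by (auto simp: scalar_prod_def sum_distrib_left lessThan_atLeast0 mult.assoc
        intro!: sum.cong)
  also have "\<dots> = (\<Sum>j<m. \<Sum>i<n. conjugate (x $ i) * conjugate (T $$ (j, i)) * y $ j)"
    by (rule sum.swap)
  also have "\<dots> = conjugate (T *\<^sub>v x) \<bullet> y"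
    using assms by (auto simp: scalar_prod_def sum_distrib_left sum_distrib_right lessThan_atLeast0
        sum_conjugate conjugate_dist_mul mult_ac intro!: sum.cong)
  finally show ?thesis .
qed

lemma index_adjoint_mult_mult:
  assumes "T \<in> carrier_mat m n" "M \<in> carrier_mat m m" "i < n" "j < n"
  shows "(mat_adjoint T * M * T) $$ (i, j) = conjugate (col T i) \<bullet> (M *\<^sub>v col T j)"
proof -
  have "row (mat_adjoint T) i = conjugate (col T i)"
    by (rule eq_vecI, use assms in auto)
  moreover have "col (M * T) j = M *\<^sub>v col T j"
    by (rule eq_vecI, use assms in auto)
  moreover have "mat_adjoint T * M * T = mat_adjoint T * (M * T)"
    using assms by (intro assoc_mult_mat) auto
  ultimately show ?thesis
    using assms by simp
qed

section \<open>Congruence and positive semidefinite matrices\<close>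

lemma psd_matsD:
  assumes "A \<in> psd_mats n"
  shows "A \<in> carrier_mat n n" "mat_adjoint A = A"
    "z \<in> carrier_vec n \<Longrightarrow> conjugate z \<bullet> (A *\<^sub>v z) \<ge> 0"
  using assms by (auto simp: psd_mats_def)

lemma zero_mat_mult_vec: "z \<in> carrier_vec n \<Longrightarrow> 0\<^sub>m m n *\<^sub>v z = (0\<^sub>v m :: 'a :: semiring_0 vec)"
  by (rule eq_vecI) auto

lemma psd_mats_zero: "0\<^sub>m n n \<in> psd_mats n"
  by (auto simp: psd_mats_def zero_mat_mult_vec)

lemma psd_mats_adjoint_mult_mult:
  assumes M: "M \<in> psd_mats n" and T: "T \<in> carrier_mat n m"
  shows "mat_adjoint T * M * T \<in> psd_mats m"
proof -
  note Mc = psd_matsD(1)[OF M]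
  have Tc: "mat_adjoint T \<in> carrier_mat m n" and TM: "mat_adjoint T * M \<in> carrier_mat m n"
    using T Mc by auto
  have "mat_adjoint (mat_adjoint T * M * T) = mat_adjoint T * (mat_adjoint M * T)"
    by (simp add: mat_adjoint_mult[OF TM T] mat_adjoint_mult[OF Tc Mc])
  also have "\<dots> = mat_adjoint T * M * T"
    by (simp add: psd_matsD(2)[OF M] assoc_mult_mat[OF Tc Mc T])
  finally have herm: "mat_adjoint (mat_adjoint T * M * T) = mat_adjoint T * M * T" .
  have "conjugate z \<bullet> ((mat_adjoint T * M * T) *\<^sub>v z) \<ge> 0" if z: "z \<in> carrier_vec m" for z
  proof -
    have Tz: "T *\<^sub>v z \<in> carrier_vec n"
      using T z by auto
    have "(mat_adjoint T * M * T) *\<^sub>v z = mat_adjoint T *\<^sub>v (M *\<^sub>v (T *\<^sub>v z))"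
      by (simp add: assoc_mult_mat_vec[OF TM T z] assoc_mult_mat_vec[OF Tc Mc Tz])
    then have "conjugate z \<bullet> ((mat_adjoint T * M * T) *\<^sub>v z)
        = conjugate (T *\<^sub>v z) \<bullet> (M *\<^sub>v (T *\<^sub>v z))"
      using T Mc z by (simp add: scalar_prod_adjoint[of T n m])
    then show ?thesis
      using psd_matsD(3)[OF M, of "T *\<^sub>v z"] T z by simp
  qed
  then show ?thesis
    using T TM herm by (auto simp: psd_mats_def)
qed

lemma psd_mats_lower_right_block:
  assumes M: "four_block_mat K (0\<^sub>m k m) (0\<^sub>m m k) D \<in> psd_mats (k + m)"
    and K: "K \<in> carrier_mat k k" and D: "D \<in> carrier_mat m m"
  shows "D \<in> psd_mats m"
proof -
  let ?M = "four_block_mat K (0\<^sub>m k m) (0\<^sub>m m k) D"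
  have "mat_adjoint D $$ (i, j) = D $$ (i, j)" if "i < m" "j < m" for i j
    using arg_cong[OF psd_matsD(2)[OF M], of "\<lambda>M. M $$ (k + i, k + j)"] K D that by simp
  then have herm: "mat_adjoint D = D"
    by (intro eq_matI) (use D in auto)
  have "conjugate z \<bullet> (D *\<^sub>v z) \<ge> 0" if z: "z \<in> carrier_vec m" for z
  proof -
    have "conjugate (0\<^sub>v k @\<^sub>v z) = 0\<^sub>v k @\<^sub>v conjugate z"
      by (rule eq_vecI) auto
    moreover have "?M *\<^sub>v (0\<^sub>v k @\<^sub>v z) = 0\<^sub>v k @\<^sub>v (D *\<^sub>v z)"
      using K D z by (subst four_block_mat_mult_vec[of _ k k _ m _ m]) auto
    ultimately have "conjugate (0\<^sub>v k @\<^sub>v z) \<bullet> (?M *\<^sub>v (0\<^sub>v k @\<^sub>v z)) = conjugate z \<bullet> (D *\<^sub>v z)"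
      using D z by (simp add: scalar_prod_append[of _ k _ m])
    then show ?thesis
      using psd_matsD(3)[OF M, of "0\<^sub>v k @\<^sub>v z"] z by simp
  qed
  then show ?thesis
    using herm D by (auto simp: psd_mats_def)
qed

text \<open>
  Polarization with the vectors \<open>x\<close> and \<open>y = A x\<close>: the cross terms of the form at
  \<open>x + y\<close> add up to \<open>2 y\<^sup>* y\<close>, so that \<open>y\<close> vanishes. The choice of \<open>y\<close> makes both
  cross terms equal, which spares a second evaluation at \<open>x + \<i> y\<close> in the complex case.
\<close>

lemma hermitian_zero_form_imp_zero:
  fixes A :: "'a :: conjugatable_ordered_field mat"
  assumes A: "A \<in> carrier_mat n n" and herm: "mat_adjoint A = A"
    and form: "\<And>z. z \<in> carrier_vec n \<Longrightarrow> conjugate z \<bullet> (A *\<^sub>v z) = 0"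
  shows "A = 0\<^sub>m n n"
proof -
  have "A *\<^sub>v x = 0\<^sub>v n" if x: "x \<in> carrier_vec n" for x
  proof -
    define y where "y = A *\<^sub>v x"
    have y: "y \<in> carrier_vec n"
      using A x by (auto simp: y_def)
    have conj_add: "conjugate (x + y) = conjugate x + conjugate y"
      by (rule conjugate_add_vec[OF x y])
    have "0 = conjugate (x + y) \<bullet> (A *\<^sub>v (x + y))"
      using form[of "x + y"] x y by simp
    also have "\<dots> = conjugate x \<bullet> (A *\<^sub>v x) + conjugate x \<bullet> (A *\<^sub>v y)
        + (conjugate y \<bullet> (A *\<^sub>v x) + conjugate y \<bullet> (A *\<^sub>v y))"
      using A x y by (simp add: conj_add mult_add_distrib_mat_vec[OF A] add_scalar_prod_distrib[of _ n]
          scalar_prod_add_distrib[of _ n])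
    also have "\<dots> = conjugate x \<bullet> (A *\<^sub>v y) + conjugate y \<bullet> (A *\<^sub>v x)"
      using form x y by simp
    also have "conjugate x \<bullet> (A *\<^sub>v y) = conjugate y \<bullet> y"
      using scalar_prod_adjoint[OF A x y] herm by (simp add: y_def)
    also have "conjugate y \<bullet> (A *\<^sub>v x) = conjugate y \<bullet> y"
      by (simp add: y_def)
    also have "conjugate y \<bullet> y = y \<bullet>c y"
      using y by (simp add: comm_scalar_prod[of _ n])
    finally have "y \<bullet>c y + y \<bullet>c y = 0"
      by simp
    moreover have "y \<bullet>c y \<ge> 0"
      by (rule conjugate_square_ge_0_vec)
    \<comment> \<open>Division by two is replaced by the order: nonnegative summands of zero vanish.\<close>
    ultimately have "y \<bullet>c y = 0"
      using add_nonneg_eq_0_iff by blast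
    then show ?thesis
      using conjugate_square_eq_0_vec[OF y] by (simp add: y_def)
  qed
  then have "A *\<^sub>v unit_vec n j = 0\<^sub>v n" for j
    by simp
  then have "A $$ (i, j) = 0" if "i < n" "j < n" for i j
  proof -
    have "row A i \<in> carrier_vec n"
      using A by auto
    then show ?thesis
      using \<open>A *\<^sub>v unit_vec n j = 0\<^sub>v n\<close>[THEN arg_cong, of "\<lambda>v. v $ i"] that A by simp
  qed
  then show ?thesis
    by (intro eq_matI) (use A in auto)
qed


definition congr :: "'a :: conjugatable_field mat \<Rightarrow> 'a mat \<Rightarrow> 'a mat" where
  "congr S M = S * M * mat_adjoint S"

lemma congr_carrier [simp]:
  "S \<in> carrier_mat m n \<Longrightarrow> M \<in> carrier_mat n n \<Longrightarrow> congr S M \<in> carrier_mat m m"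
  unfolding congr_def by (intro mult_carrier_mat mat_adjoint_carrier)

lemma congr_congr:
  assumes S: "S \<in> carrier_mat l m" and U: "U \<in> carrier_mat m n" and M: "M \<in> carrier_mat n n"
  shows "congr S (congr U M) = congr (S * U) M"
proof -
  have Sa: "mat_adjoint S \<in> carrier_mat m l" and Ua: "mat_adjoint U \<in> carrier_mat n m"
    using S U by simp_all
  have UM: "U * M \<in> carrier_mat m n" and SU: "S * U \<in> carrier_mat l n"
    and SUM: "S * U * M \<in> carrier_mat l n"
    using S U M by auto
  have "S * (U * M * mat_adjoint U) = S * U * M * mat_adjoint U"
    using assoc_mult_mat[OF S UM Ua] assoc_mult_mat[OF S U M] by simp
  then show ?thesis
    unfolding congr_def mat_adjoint_mult[OF S U]
    using assoc_mult_mat[OF SUM Ua Sa] by simp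
qed

lemma congr_one [simp]: "M \<in> carrier_mat n n \<Longrightarrow> congr (1\<^sub>m n) M = M"
  by (simp add: congr_def)

lemma congr_cancel:
  assumes "S \<in> carrier_mat n n" "R \<in> carrier_mat n n" "S * R = 1\<^sub>m n" "M \<in> carrier_mat n n"
  shows "congr S (congr R M) = M"
  using assms by (simp add: congr_congr)

lemma congr_add:
  assumes S: "S \<in> carrier_mat m n" and M: "M \<in> carrier_mat n n" and N: "N \<in> carrier_mat n n"
  shows "congr S (M + N) = congr S M + congr S N"
proof -
  have "S * M \<in> carrier_mat m n" "S * N \<in> carrier_mat m n" "mat_adjoint S \<in> carrier_mat n m"
    using assms by auto
  then show ?thesis
    unfolding congr_def by (simp add: mult_add_distrib_mat[OF S M N] add_mult_distrib_mat[of _ m n])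
qed

text \<open>
  Invertible matrices are carried along together with an inverse; this composes two such pairs.
\<close>

lemma mult_inverse_pairs:
  assumes "S \<in> carrier_mat n n" "R \<in> carrier_mat n n" "S * R = 1\<^sub>m n"
    and "U \<in> carrier_mat n n" "V \<in> carrier_mat n n" "U * V = 1\<^sub>m n"
  shows "(S * U) * (V * R) = (1\<^sub>m n :: 'a :: semiring_1 mat)"
proof -
  have "(S * U) * (V * R) = S * (U * V) * R"
    using assms(1,2,4,5)
    by (simp add: assoc_mult_mat[of _ n n _ n _ n] mult_carrier_mat[of _ n n _ n])
  then show ?thesis
    using assms by simp
qed

lemma psd_mats_congr:
  assumes "M \<in> psd_mats n" "T \<in> carrier_mat m n"
  shows "congr T M \<in> psd_mats m"
  using psd_mats_adjoint_mult_mult[OF assms(1), of "mat_adjoint T" m] assms(2) by (simp add: congr_def)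

section \<open>Bordering a matrix by one row and one column\<close>

text \<open>
  The corner is itself a one by one matrix, so that products, sums and adjoints of bordered matrices
  can be taken block by block without passing between scalars and matrices.
\<close>

definition border :: "'a :: zero mat \<Rightarrow> 'a mat \<Rightarrow> 'a mat" where
  "border K D = four_block_mat K (0\<^sub>m 1 (dim_col D)) (0\<^sub>m (dim_row D) 1) D"

lemma border_carrier [simp]:
  "K \<in> carrier_mat 1 1 \<Longrightarrow> D \<in> carrier_mat m m \<Longrightarrow> border K D \<in> carrier_mat (Suc m) (Suc m)"
  unfolding border_def using four_block_carrier_mat[of K 1 1 D m m] by simp

lemma border_mult:
  assumes "K \<in> carrier_mat 1 1" "D \<in> carrier_mat m m" "K' \<in> carrier_mat 1 1" "D' \<in> carrier_mat m m"
  shows "border K D * border K' D' = border (K * K') (D * D' :: 'a :: semiring_0 mat)"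
  unfolding border_def using assms
  by (subst mult_four_block_mat[of _ 1 1 _ m _ m _ _ 1 _ m]) auto

lemma border_adjoint:
  assumes "K \<in> carrier_mat 1 1" "D \<in> carrier_mat m m"
  shows "mat_adjoint (border K D) = border (mat_adjoint K) (mat_adjoint D)"
  unfolding border_def using assms
  by (subst mat_adjoint_four_block[of _ 1 1 _ m _ m]) auto

lemma congr_border:
  assumes "U \<in> carrier_mat m m" "K \<in> carrier_mat 1 1" "D \<in> carrier_mat m m"
  shows "congr (border (1\<^sub>m 1) U) (border K D) = border K (congr U D)"
  using assms by (simp add: congr_def border_adjoint[of _ _ m] border_mult[of _ _ m])

lemma border_add:
  assumes "K \<in> carrier_mat 1 1" "D \<in> carrier_mat m m" "K' \<in> carrier_mat 1 1" "D' \<in> carrier_mat m m"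
  shows "border K D + border K' D' = border (K + K') (D + D' :: 'a :: monoid_add mat)"
  by (rule eq_matI) (use assms in \<open>auto simp: border_def\<close>)

lemma border_one: "border (1\<^sub>m 1) (1\<^sub>m m) = 1\<^sub>m (Suc m)"
  unfolding border_def by (rule eq_matI) auto

lemma id_block_mat_eq:
  "r \<le> n \<Longrightarrow> id_block_mat n r = mat n n (\<lambda>(i, j). if i = j \<and> i < r then 1 else 0)"
  unfolding id_block_mat_def by (rule eq_matI) auto

lemma id_block_mat_carrier [simp]: "r \<le> n \<Longrightarrow> id_block_mat n r \<in> carrier_mat n n"
  by (simp add: id_block_mat_eq)

lemma id_block_mat_zero [simp]: "id_block_mat n 0 = 0\<^sub>m n n"
  by (rule eq_matI) (auto simp: id_block_mat_eq)

lemma border_id_block_mat: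
  "r \<le> m \<Longrightarrow> border (1\<^sub>m 1) (id_block_mat m r) = id_block_mat (Suc m) (Suc r)"
  by (rule eq_matI) (auto simp: id_block_mat_eq border_def)

lemma id_block_mat_mult:
  assumes "r \<le> s" "s \<le> n"
  shows "id_block_mat n r * id_block_mat n s = (id_block_mat n r :: 'a :: semiring_1 mat)"
    and "id_block_mat n s * id_block_mat n r = (id_block_mat n r :: 'a :: semiring_1 mat)"
proof -
  have "(\<Sum>k = 0..<n. (if i = k \<and> i < p then 1 else 0) * (if k = j \<and> k < q then 1 else 0))
      = (if i = j \<and> i < p \<and> j < q then 1 else 0 :: 'a)" if "i < n" for i j p q
  proof -
    have "(\<Sum>k = 0..<n. (if i = k \<and> i < p then 1 else 0) * (if k = j \<and> k < q then 1 else 0))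
        = (\<Sum>k = 0..<n. if k = i then if i = j \<and> i < p \<and> j < q then 1 else 0 else 0 :: 'a)"
      by (rule sum.cong) auto
    then show ?thesis
      using that by simp
  qed
  then show "id_block_mat n r * id_block_mat n s = (id_block_mat n r :: 'a mat)"
    "id_block_mat n s * id_block_mat n r = (id_block_mat n r :: 'a mat)"
    using assms by (auto simp: id_block_mat_eq scalar_prod_def intro!: eq_matI)
qed

section \<open>Splitting off a rank-one summand\<close>

text \<open>
  Orthogonalizing a basis that starts with \<open>w\<close> keeps \<open>w\<close>. Orthogonality as such is not the
  aim: it makes the inverse of the matrix of basis vectors explicit.
\<close>

lemma ex_invertible_mat_first_col:
  fixes w :: "'a :: conjugatable_ordered_field vec"
  assumes w: "w \<in> carrier_vec n" and w0: "w \<noteq> 0\<^sub>v n"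
  shows "\<exists>E E'. E \<in> carrier_mat n n \<and> E' \<in> carrier_mat n n \<and> E * E' = 1\<^sub>m n \<and> E' * E = 1\<^sub>m n \<and>
    col E 0 = w"
proof -
  interpret cof_vec_space n "TYPE('a)" .
  have n: "n \<noteq> 0"
    using w w0 by (metis carrier_vecD eq_vecI index_zero_vec(2) less_nat_zero_code)
  define b where "b = basis_completion w"
  from basis_completion[OF w w0, folded b_def]
  have dist_b: "distinct b" and indep: "\<not> lin_dep (set b)" and b: "set b \<subseteq> carrier_vec n"
    and hdb: "hd b = w" and len_b: "length b = n"
    by auto
  then obtain vs where bw: "b = w # vs"
    using n by (cases b) auto
  define ws where "ws = gram_schmidt n b"
  have ws: "set ws \<subseteq> carrier_vec n" "corthogonal ws" "length ws = n"
    using gram_schmidt_result[OF b dist_b indep refl, folded ws_def] by (auto simp: len_b)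
  have hdws: "hd ws = w"
    using gram_schmidt_hd[OF w, of vs, folded bw] by (simp add: ws_def)
  define E where "E = mat_of_cols n ws"
  define E' where "E' = corthogonal_inv E"
  have E: "E \<in> carrier_mat n n"
    using mat_of_cols_carrier(1)[of n ws] ws by (simp add: E_def)
  have E': "E' \<in> carrier_mat n n"
    using E by (auto simp: E'_def corthogonal_inv_def mat_of_rows_def)
  have "corthogonal_mat E"
    using orthogonal_mat_of_cols ws unfolding E_def .
  then have E'E: "E' * E = 1\<^sub>m n"
    using corthogonal_inv_result[of E] E E' by (auto simp: E'_def inverts_mat_def)
  then have "E * E' = 1\<^sub>m n"
    using mat_mult_left_right_inverse[OF E' E] by simp
  moreover have "col E 0 = w"
    using ws hdws n by (cases ws) (auto simp: E_def)
  ultimately show ?thesis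
    using E E' E'E by blast
qed

text \<open>
  The real and the complex numbers are treated uniformly through the property they share and the
  rationals lack: every nonnegative element is some \<open>b\<close> times its conjugate. This is what allows a
  positive diagonal entry to be scaled to one by a congruence.
\<close>

class conjugatable_sqrt_field = conjugatable_ordered_field +
  assumes ex_conjugate_sqrt: "0 \<le> a \<Longrightarrow> \<exists>b. b * conjugate b = a"

instance real :: conjugatable_sqrt_field
  by standard (metis conjugate_real_def real_sqrt_mult_self abs_of_nonneg)

instance complex :: conjugatable_sqrt_field
proof
  fix a :: complex
  assume "0 \<le> a"
  then have "complex_of_real (sqrt (Re a)) * conjugate (complex_of_real (sqrt (Re a))) = a"
    by (auto simp: less_eq_complex_def complex_eq_iff)
  then show "\<exists>b. b * conjugate b = a" ..
qed

text \<open>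
  The form of \<open>A\<close> takes the same value at \<open>P\<^sup>* z\<close> as at \<open>z\<close>, since \<open>P A P\<^sup>* = A\<close>, whereas
  \<open>C P\<^sup>* = (P C)\<^sup>* = 0\<close>. So any \<open>z\<close> at which the form of \<open>A\<close> is nonzero can be moved into the
  kernel of \<open>C\<close> and then scaled.
\<close>

lemma ex_normalized_vec_in_kernel:
  fixes A C P :: "'a :: conjugatable_sqrt_field mat"
  assumes A: "A \<in> psd_mats n" and C: "C \<in> psd_mats n" and P: "P \<in> carrier_mat n n"
    and PA: "P * A = A" and PC: "P * C = 0\<^sub>m n n" and A0: "A \<noteq> 0\<^sub>m n n"
  shows "\<exists>w \<in> carrier_vec n. conjugate w \<bullet> (A *\<^sub>v w) = 1 \<and> C *\<^sub>v w = 0\<^sub>v n"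
proof -
  note Ac = psd_matsD(1)[OF A] and Cc = psd_matsD(1)[OF C]
  obtain z where z: "z \<in> carrier_vec n" and nz: "conjugate z \<bullet> (A *\<^sub>v z) \<noteq> 0"
    using hermitian_zero_form_imp_zero[OF Ac psd_matsD(2)[OF A]] A0 by blast
  define v where "v = mat_adjoint P *\<^sub>v z"
  have Pa: "mat_adjoint P \<in> carrier_mat n n"
    using P by simp
  then have v: "v \<in> carrier_vec n"
    using z by (auto simp: v_def)
  have "A * mat_adjoint P = mat_adjoint (P * A)" "C * mat_adjoint P = mat_adjoint (P * C)"
    by (simp_all add: mat_adjoint_mult[OF P Ac] mat_adjoint_mult[OF P Cc] psd_matsD(2)[OF A]
        psd_matsD(2)[OF C])
  then have AP: "A * mat_adjoint P = A" and CP: "C * mat_adjoint P = 0\<^sub>m n n"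
    by (simp_all add: PA PC psd_matsD(2)[OF A])
  have Av: "A *\<^sub>v v = A *\<^sub>v z"
    using assoc_mult_mat_vec[OF Ac Pa z] by (simp add: v_def AP)
  have Cv: "C *\<^sub>v v = 0\<^sub>v n"
    using assoc_mult_mat_vec[OF Cc Pa z] z by (simp add: v_def CP zero_mat_mult_vec)
  have Az: "A *\<^sub>v z \<in> carrier_vec n"
    using Ac z by auto
  have "conjugate v \<bullet> (A *\<^sub>v v) = conjugate z \<bullet> (P *\<^sub>v (A *\<^sub>v z))"
    using scalar_prod_adjoint[OF Pa z Az] by (simp add: v_def[symmetric] Av)
  also have "P *\<^sub>v (A *\<^sub>v z) = A *\<^sub>v z"
    using assoc_mult_mat_vec[OF P Ac z] PA by simp
  finally have vAv: "conjugate v \<bullet> (A *\<^sub>v v) = conjugate z \<bullet> (A *\<^sub>v z)" .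
  obtain b where b: "b * conjugate b = conjugate z \<bullet> (A *\<^sub>v z)"
    using ex_conjugate_sqrt psd_matsD(3)[OF A z] by blast
  with nz have b0: "b \<noteq> 0"
    by auto
  define c where "c = inverse b"
  have cb: "c * b = 1"
    using b0 by (simp add: c_def)
  define w where "w = c \<cdot>\<^sub>v v"
  have "conjugate w \<bullet> (A *\<^sub>v w) = conjugate c * (c * (conjugate v \<bullet> (A *\<^sub>v v)))"
    using v Ac by (simp add: w_def conjugate_smult_vec mult_mat_vec[of _ n n])
  also have "\<dots> = (c * b) * conjugate (c * b)"
    by (simp add: vAv b[symmetric] conjugate_dist_mul mult_ac)
  finally have "conjugate w \<bullet> (A *\<^sub>v w) = 1"
    by (simp add: cb)
  moreover have "C *\<^sub>v w = 0\<^sub>v n"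
    using Cv v Cc by (auto simp: w_def mult_mat_vec[of _ n n])
  ultimately show ?thesis
    using v by (intro bexI[of _ w]) (auto simp: w_def)
qed

text \<open>
  One step of symmetric Gaussian elimination, with the unit corner of \<open>A\<close> as pivot. The first row
  and column of \<open>C\<close> vanish, so adding multiples of them to the others leaves \<open>C\<close> unchanged.
\<close>

lemma ex_congr_border:
  fixes A C :: "'a :: conjugatable_field mat"
  assumes A: "A \<in> carrier_mat (Suc m) (Suc m)" "mat_adjoint A = A" "A $$ (0, 0) = 1"
    and C: "C \<in> carrier_mat (Suc m) (Suc m)" "mat_adjoint C = C"
    and C0: "\<And>i. i < Suc m \<Longrightarrow> C $$ (i, 0) = 0"
  shows "\<exists>L L' A' C'. L \<in> carrier_mat (Suc m) (Suc m) \<and> L' \<in> carrier_mat (Suc m) (Suc m) \<and>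
    L * L' = 1\<^sub>m (Suc m) \<and> A' \<in> carrier_mat m m \<and> C' \<in> carrier_mat m m \<and>
    congr L A = border (1\<^sub>m 1) A' \<and> congr L C = border (0\<^sub>m 1 1) C'"
proof -
  define b where "b = mat 1 m (\<lambda>(i, j). A $$ (0, Suc j))"
  define D where "D = mat m m (\<lambda>(i, j). A $$ (Suc i, Suc j))"
  define C' where "C' = mat m m (\<lambda>(i, j). C $$ (Suc i, Suc j))"
  \<comment> \<open>The row operation \<open>L\<close> clears the first column below the pivot; \<open>L'\<close> undoes it.\<close>
  define L where "L = four_block_mat (1\<^sub>m 1) (0\<^sub>m 1 m) (- mat_adjoint b) (1\<^sub>m m)"
  define L' where "L' = four_block_mat (1\<^sub>m 1) (0\<^sub>m 1 m) (mat_adjoint b) (1\<^sub>m m)"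
  have b: "b \<in> carrier_mat 1 m" and D: "D \<in> carrier_mat m m" and C': "C' \<in> carrier_mat m m"
    by (auto simp: b_def D_def C'_def)
  have ba: "mat_adjoint b \<in> carrier_mat m 1" and bm: "- mat_adjoint b \<in> carrier_mat m 1"
    using b by auto
  have herm: "A $$ (i, j) = conjugate (A $$ (j, i))" "C $$ (i, j) = conjugate (C $$ (j, i))"
    if "i < Suc m" "j < Suc m" for i j
    using arg_cong[OF A(2), of "\<lambda>M. M $$ (i, j)"] arg_cong[OF C(2), of "\<lambda>M. M $$ (i, j)"]
      A(1) C(1) that by auto
  have Ab: "A = four_block_mat (1\<^sub>m 1) b (mat_adjoint b) D"
    by (rule eq_matI)
      (use A(1,3) herm(1)[of "Suc _" 0] in \<open>auto simp: b_def D_def less_Suc_eq_0_disj\<close>)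
  have "C $$ (0, i) = 0" if "i < Suc m" for i
    using herm(2)[of 0 i] C0 that by simp
  then have Cb: "C = border (0\<^sub>m 1 1) C'"
    by (intro eq_matI) (use C(1) C0 in \<open>auto simp: C'_def border_def less_Suc_eq_0_disj\<close>)
  have Lc: "L \<in> carrier_mat (Suc m) (Suc m)" "L' \<in> carrier_mat (Suc m) (Suc m)"
    by (auto simp: L_def L'_def)
  have cancel: "- mat_adjoint b * 1\<^sub>m 1 + 1\<^sub>m m * mat_adjoint b = 0\<^sub>m m 1"
    by (rule eq_matI) (use b in auto)
  have LL': "L * L' = 1\<^sub>m (Suc m)"
    unfolding L_def L'_def using ba bm
    by (subst mult_four_block_mat[of _ 1 1 _ m _ m _ _ 1 _ m])
      (simp_all add: cancel[simplified] left_mult_zero_mat[OF ba, simplified]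
        right_mult_zero_mat[OF bm, simplified])
  have La: "mat_adjoint L = four_block_mat (1\<^sub>m 1) (- b) (0\<^sub>m m 1) (1\<^sub>m m)"
  proof -
    have "mat_adjoint (- mat_adjoint b) = - b"
      by (rule eq_matI) (auto simp: conjugate_neg)
    then show ?thesis
      unfolding L_def using bm by (subst mat_adjoint_four_block[of _ 1 1 _ m _ m]) auto
  qed
  have "L * A = four_block_mat (1\<^sub>m 1) b (0\<^sub>m m 1) (D - mat_adjoint b * b)"
  proof -
    have "- mat_adjoint b * b + 1\<^sub>m m * D = D - mat_adjoint b * b"
      by (rule eq_matI) (use b D in auto)
    with cancel show ?thesis
      unfolding L_def Ab using b ba bm D
      by (subst mult_four_block_mat[of _ 1 1 _ m _ m _ _ 1 _ m]) auto
  qed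
  moreover have "four_block_mat (1\<^sub>m 1) b (0\<^sub>m m 1) (D - mat_adjoint b * b) * mat_adjoint L =
      border (1\<^sub>m 1) (D - mat_adjoint b * b)"
  proof -
    have "1\<^sub>m 1 * (- b) + b * 1\<^sub>m m = 0\<^sub>m 1 m"
      by (rule eq_matI) (use b in auto)
    then show ?thesis
      unfolding La border_def using b ba D
      by (subst mult_four_block_mat[of _ 1 1 _ m _ m _ _ 1 _ m]) auto
  qed
  ultimately have LA: "congr L A = border (1\<^sub>m 1) (D - mat_adjoint b * b)"
    by (simp add: congr_def)
  have "L * C = C"
    unfolding L_def Cb border_def using bm C'
    by (subst mult_four_block_mat[of _ 1 1 _ m _ m _ _ 1 _ m])
      (simp_all add: right_mult_zero_mat[OF bm, simplified])
  moreover have "C * mat_adjoint L = C"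
    unfolding La Cb border_def using b C'
    by (subst mult_four_block_mat[of _ 1 1 _ m _ m _ _ 1 _ m]) auto
  ultimately have "congr L C = border (0\<^sub>m 1 1) C'"
    using Cb by (simp add: congr_def)
  moreover have "D - mat_adjoint b * b \<in> carrier_mat m m"
    using b ba D by auto
  ultimately show ?thesis
    using Lc LL' LA C' by blast
qed

text \<open>
  In a product with a bordered matrix, the off-diagonal blocks of the left factor do not reach the
  lower right block. Hence the lower right block of a matrix that separates two bordered matrices
  separates their lower right blocks.
\<close>

lemma ex_mult_border_lower_right:
  fixes P :: "'a :: comm_ring_1 mat"
  assumes P: "P \<in> carrier_mat (Suc m) (Suc m)"
  shows "\<exists>P' \<in> carrier_mat m m. \<forall>K \<in> carrier_mat 1 1. \<forall>D \<in> carrier_mat m m. \<forall>i < m. \<forall>j < m.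
    (P * border K D) $$ (Suc i, Suc j) = (P' * D) $$ (i, j)"
proof -
  define P' where "P' = mat m m (\<lambda>(i, j). P $$ (Suc i, Suc j))"
  have "(P * border K D) $$ (Suc i, Suc j) = (P' * D) $$ (i, j)"
    if "K \<in> carrier_mat 1 1" "D \<in> carrier_mat m m" "i < m" "j < m" for K D i j
    using that P
    by (simp add: scalar_prod_def border_def P'_def sum.atLeast0_lessThan_Suc_shift
        del: sum.op_ivl_Suc)
  then show ?thesis
    by (intro bexI[of _ P']) (auto simp: P'_def)
qed

text \<open>
  The induction step. The hypothesis on \<open>P\<close> says that the ranges of \<open>A\<close> and \<open>C\<close> are
  separated, and it reappears in the conclusion for the smaller matrices. With \<open>C = 0\<close> and the
  identity for \<open>P\<close> the lemma also serves to diagonalize a single matrix.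
\<close>

lemma ex_split_off_rank_one:
  fixes A C P :: "'a :: conjugatable_sqrt_field mat"
  assumes A: "A \<in> psd_mats (Suc m)" and C: "C \<in> psd_mats (Suc m)"
    and P: "P \<in> carrier_mat (Suc m) (Suc m)" and PA: "P * A = A"
    and PC: "P * C = 0\<^sub>m (Suc m) (Suc m)" and A0: "A \<noteq> 0\<^sub>m (Suc m) (Suc m)"
  shows "\<exists>S R A' C' P'. S \<in> carrier_mat (Suc m) (Suc m) \<and> R \<in> carrier_mat (Suc m) (Suc m) \<and>
    S * R = 1\<^sub>m (Suc m) \<and> R * S = 1\<^sub>m (Suc m) \<and>
    A' \<in> psd_mats m \<and> C' \<in> psd_mats m \<and> P' \<in> carrier_mat m m \<and> P' * A' = A' \<and>
    P' * C' = 0\<^sub>m m m \<and>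
    A = congr S (border (1\<^sub>m 1) A') \<and> C = congr S (border (0\<^sub>m 1 1) C')"
proof -
  let ?n = "Suc m"
  note Ac = psd_matsD(1)[OF A] and Cc = psd_matsD(1)[OF C]
  obtain w where w: "w \<in> carrier_vec ?n" and wAw: "conjugate w \<bullet> (A *\<^sub>v w) = 1"
    and Cw: "C *\<^sub>v w = 0\<^sub>v ?n"
    using ex_normalized_vec_in_kernel[OF A C P PA PC A0] by blast
  have "w \<noteq> 0\<^sub>v ?n"
    using wAw Ac by (auto simp: scalar_prod_def)
  then obtain E E' where E: "E \<in> carrier_mat ?n ?n" and E': "E' \<in> carrier_mat ?n ?n"
    and EE': "E * E' = 1\<^sub>m ?n" and E'E: "E' * E = 1\<^sub>m ?n" and Ew: "col E 0 = w"
    using ex_invertible_mat_first_col[OF w] by blast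
  \<comment> \<open>In the basis of the columns of \<open>E\<close> the first basis vector is \<open>w\<close>, which makes the corner
    of \<open>A\<close> equal to one and kills the first column of \<open>C\<close>.\<close>
  define F where "F = mat_adjoint E"
  define F' where "F' = mat_adjoint E'"
  have F: "F \<in> carrier_mat ?n ?n" and F': "F' \<in> carrier_mat ?n ?n"
    using E E' by (auto simp: F_def F'_def)
  have FF': "F * F' = 1\<^sub>m ?n" and F'F: "F' * F = 1\<^sub>m ?n"
    by (simp_all add: F_def F'_def E'E EE' flip: mat_adjoint_mult[OF E' E] mat_adjoint_mult[OF E E'])
  have FA: "congr F A \<in> psd_mats ?n" and FC: "congr F C \<in> psd_mats ?n"
    using psd_mats_congr A C F by auto
  have "congr F A $$ (0, 0) = 1"
    using index_adjoint_mult_mult[OF E Ac, of 0 0] Ew wAw by (simp add: congr_def F_def)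
  moreover have "congr F C $$ (i, 0) = 0" if "i < ?n" for i
  proof -
    have "conjugate (col E i) \<in> carrier_vec ?n"
      by (rule carrier_vecI) (use E in simp)
    then show ?thesis
      using index_adjoint_mult_mult[OF E Cc that, of 0] Ew Cw by (simp add: congr_def F_def)
  qed
  ultimately obtain L L' A' C' where L: "L \<in> carrier_mat ?n ?n" and L': "L' \<in> carrier_mat ?n ?n"
    and LL': "L * L' = 1\<^sub>m ?n"
    and A': "A' \<in> carrier_mat m m" and C': "C' \<in> carrier_mat m m"
    and LA: "congr L (congr F A) = border (1\<^sub>m 1) A'"
    and LC: "congr L (congr F C) = border (0\<^sub>m 1 1) C'"
    using ex_congr_border[OF psd_matsD(1,2)[OF FA] _ psd_matsD(1,2)[OF FC]] by blast
  define R where "R = L * F"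
  define S where "S = F' * L'"
  have R: "R \<in> carrier_mat ?n ?n" and S: "S \<in> carrier_mat ?n ?n"
    using L F L' F' by (auto simp: R_def S_def)
  have RS: "R * S = 1\<^sub>m ?n"
    unfolding R_def S_def by (rule mult_inverse_pairs[OF L L' LL' F F' FF'])
  then have SR: "S * R = 1\<^sub>m ?n"
    using mat_mult_left_right_inverse[OF R S] by simp
  have RA: "congr R A = border (1\<^sub>m 1) A'" and RC: "congr R C = border (0\<^sub>m 1 1) C'"
    using LA LC by (simp_all add: R_def congr_congr[OF L F] Ac Cc)
  have "congr R A \<in> psd_mats (1 + m)" "congr R C \<in> psd_mats (1 + m)"
    using psd_mats_congr[OF A R] psd_mats_congr[OF C R] by auto
  then have A'psd: "A' \<in> psd_mats m" and C'psd: "C' \<in> psd_mats m"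
    using A' C' unfolding RA RC border_def
    by (auto intro: psd_mats_lower_right_block[of _ 1])
  \<comment> \<open>\<open>P\<close> acts from the left only, so it transforms by similarity while \<open>A\<close> and \<open>C\<close>
    transform by congruence.\<close>
  define Q where "Q = R * P * S"
  have Q: "Q \<in> carrier_mat ?n ?n"
    using R P S by (auto simp: Q_def)
  have Qcongr: "Q * congr R M = R * (P * M) * mat_adjoint R" if M: "M \<in> carrier_mat ?n ?n" for M
  proof -
    have Ra: "mat_adjoint R \<in> carrier_mat ?n ?n"
      using R by simp
    have "Q * congr R M = R * P * (S * R) * M * mat_adjoint R"
      unfolding Q_def congr_def using R P S M Ra
      by (simp add: assoc_mult_mat[of _ ?n ?n _ ?n _ ?n] mult_carrier_mat[of _ ?n ?n])
    also have "\<dots> = R * (P * M) * mat_adjoint R"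
      unfolding SR using R P M by (simp add: assoc_mult_mat[of R ?n ?n P ?n M ?n])
    finally show ?thesis .
  qed
  have QA: "Q * border (1\<^sub>m 1) A' = border (1\<^sub>m 1) A'"
    unfolding RA[symmetric] Qcongr[OF Ac] PA by (simp add: congr_def)
  have QC: "Q * border (0\<^sub>m 1 1) C' = 0\<^sub>m ?n ?n"
    unfolding RC[symmetric] Qcongr[OF Cc] PC using R by simp
  obtain P' where P': "P' \<in> carrier_mat m m"
    and P'_index: "\<And>K D i j. K \<in> carrier_mat 1 1 \<Longrightarrow> D \<in> carrier_mat m m \<Longrightarrow> i < m \<Longrightarrow> j < m \<Longrightarrow>
      (Q * border K D) $$ (Suc i, Suc j) = (P' * D) $$ (i, j)"
    using ex_mult_border_lower_right[OF Q] by blast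
  have "P' * A' = A'"
    by (rule eq_matI) (use P' A' P'_index[of "1\<^sub>m 1" A'] QA in \<open>auto simp: border_def\<close>)
  moreover have "P' * C' = 0\<^sub>m m m"
    by (rule eq_matI) (use P' C' P'_index[of "0\<^sub>m 1 1" C'] QC in auto)
  moreover have "A = congr S (border (1\<^sub>m 1) A')" "C = congr S (border (0\<^sub>m 1 1) C')"
    using congr_cancel[OF S R SR Ac] congr_cancel[OF S R SR Cc] by (simp_all add: RA RC)
  ultimately show ?thesis
    using S R SR RS A'psd C'psd P' by blast
qed

section \<open>Simultaneous diagonalization\<close>

lemma mult_border_inverse:
  assumes S: "S \<in> carrier_mat (Suc m) (Suc m)" "R \<in> carrier_mat (Suc m) (Suc m)"
      "S * R = 1\<^sub>m (Suc m)" "R * S = 1\<^sub>m (Suc m)"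
    and U: "U \<in> carrier_mat m m" "V \<in> carrier_mat m m" "U * V = 1\<^sub>m m" "V * U = 1\<^sub>m m"
  shows "S * border (1\<^sub>m 1) U \<in> carrier_mat (Suc m) (Suc m)"
    and "border (1\<^sub>m 1) V * R \<in> carrier_mat (Suc m) (Suc m)"
    and "(S * border (1\<^sub>m 1) U) * (border (1\<^sub>m 1) V * R) = 1\<^sub>m (Suc m)"
    and "(border (1\<^sub>m 1) V * R) * (S * border (1\<^sub>m 1) U) = (1\<^sub>m (Suc m) :: 'a :: field mat)"
proof -
  let ?n = "Suc m" and ?U = "border (1\<^sub>m 1) U" and ?V = "border (1\<^sub>m 1) V"
  have UV: "?U \<in> carrier_mat ?n ?n" "?V \<in> carrier_mat ?n ?n" "?U * ?V = 1\<^sub>m ?n"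
    using U by (simp_all add: border_mult[of _ _ m] border_one[simplified])
  show c: "S * ?U \<in> carrier_mat ?n ?n" "?V * R \<in> carrier_mat ?n ?n"
    using S UV by auto
  show SUVR: "(S * ?U) * (?V * R) = 1\<^sub>m ?n"
    by (rule mult_inverse_pairs) (use S UV in auto)
  show "(?V * R) * (S * ?U) = 1\<^sub>m ?n"
    by (rule mat_mult_left_right_inverse[OF c SUVR])
qed

lemma congr_border_id_block_mat:
  assumes S: "S \<in> carrier_mat (Suc m) (Suc m)" and U: "U \<in> carrier_mat m m" and r: "r \<le> m"
  shows "congr S (border (1\<^sub>m 1) (congr U (id_block_mat m r))) =
    congr (S * border (1\<^sub>m 1) U) (id_block_mat (Suc m) (Suc r))"
proof -
  have "border (1\<^sub>m 1) (congr U (id_block_mat m r)) =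
      congr (border (1\<^sub>m 1) U) (id_block_mat (Suc m) (Suc r))"
    unfolding border_id_block_mat[OF r, symmetric]
    by (rule congr_border[symmetric]) (use U r in auto)
  then show ?thesis
    using congr_congr[OF S border_carrier[OF one_carrier_mat U]] r by simp
qed

text \<open>
  Sylvester's normal form for a positive semidefinite matrix: splitting off rank-one summands stops
  exactly when the remaining block is zero.
\<close>

lemma psd_mats_congr_id_block_mat:
  fixes C :: "'a :: conjugatable_sqrt_field mat"
  assumes "C \<in> psd_mats n"
  shows "\<exists>S R s. S \<in> carrier_mat n n \<and> R \<in> carrier_mat n n \<and> S * R = 1\<^sub>m n \<and> R * S = 1\<^sub>m n \<and>
    s \<le> n \<and> C = congr S (id_block_mat n s)"
  using assms
proof (induction n arbitrary: C)
  case 0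
  then have "C = congr (1\<^sub>m 0) (id_block_mat 0 0)"
    by (auto simp: psd_mats_def congr_def)
  then show ?case
    by (intro exI[of _ "1\<^sub>m 0"] exI[of _ "0 :: nat"]) auto
next
  case (Suc m)
  let ?n = "Suc m"
  note Cc = psd_matsD(1)[OF Suc.prems]
  show ?case
  proof (cases "C = 0\<^sub>m ?n ?n")
    case True
    then show ?thesis
      by (intro exI[of _ "1\<^sub>m ?n"] exI[of _ "0 :: nat"]) auto
  next
    case False
    have "1\<^sub>m ?n * C = C" "1\<^sub>m ?n * 0\<^sub>m ?n ?n = (0\<^sub>m ?n ?n :: 'a mat)"
      using Cc by auto
    then obtain S R C' where S: "S \<in> carrier_mat ?n ?n" "R \<in> carrier_mat ?n ?n"
        "S * R = 1\<^sub>m ?n" "R * S = 1\<^sub>m ?n"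
      and C': "C' \<in> psd_mats m" and C: "C = congr S (border (1\<^sub>m 1) C')"
      using ex_split_off_rank_one[OF Suc.prems psd_mats_zero one_carrier_mat _ _ False] by blast
    obtain U V s where U: "U \<in> carrier_mat m m" "V \<in> carrier_mat m m" "U * V = 1\<^sub>m m" "V * U = 1\<^sub>m m"
      and s: "s \<le> m" and C'U: "C' = congr U (id_block_mat m s)"
      using Suc.IH[OF C'] by blast
    have "C = congr (S * border (1\<^sub>m 1) U) (id_block_mat ?n (Suc s))"
      using congr_border_id_block_mat[OF S(1) U(1), of s] s by (simp add: C C'U)
    then show ?thesis
      using mult_border_inverse[OF S U] s by (metis Suc_le_mono)
  qed
qed

text \<open>
  The entries of \<open>A\<close> are split off first, and each of them counts in the normal form of \<open>A\<close> and
  of \<open>A + C\<close> alike. When \<open>A\<close> is used up, the normal form of the rest of \<open>C\<close> may be taken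
  with any congruence, because a zero block stays zero. This order is what places the ones of \<open>A\<close>
  before those of \<open>C\<close>.
\<close>

lemma psd_mats_simultaneous_congr:
  fixes A C P :: "'a :: conjugatable_sqrt_field mat"
  assumes "A \<in> psd_mats n" "C \<in> psd_mats n" "P \<in> carrier_mat n n" "P * A = A" "P * C = 0\<^sub>m n n"
  shows "\<exists>S R r s. S \<in> carrier_mat n n \<and> R \<in> carrier_mat n n \<and> S * R = 1\<^sub>m n \<and> R * S = 1\<^sub>m n \<and>
    r \<le> s \<and> s \<le> n \<and> A = congr S (id_block_mat n r) \<and> A + C = congr S (id_block_mat n s)"
  using assms
proof (induction n arbitrary: A C P)
  case 0
  then have "A = congr (1\<^sub>m 0) (id_block_mat 0 0)" "A + C = congr (1\<^sub>m 0) (id_block_mat 0 0)"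
    by (auto simp: psd_mats_def congr_def)
  then show ?case
    by (intro exI[of _ "1\<^sub>m 0"] exI[of _ "0 :: nat"]) auto
next
  case (Suc m)
  let ?n = "Suc m"
  show ?case
  proof (cases "A = 0\<^sub>m ?n ?n")
    case True
    obtain S R s where S: "S \<in> carrier_mat ?n ?n" "R \<in> carrier_mat ?n ?n"
        "S * R = 1\<^sub>m ?n" "R * S = 1\<^sub>m ?n"
      and s: "s \<le> ?n" and C: "C = congr S (id_block_mat ?n s)"
      using psd_mats_congr_id_block_mat[OF Suc.prems(2)] by blast
    have "A = congr S (id_block_mat ?n 0)"
      using S by (simp add: True congr_def)
    moreover have "A + C = congr S (id_block_mat ?n s)"
      using S s C by (simp add: True)
    ultimately show ?thesis
      using S s by blast
  next
    case False
    obtain S R A' C' P' where S: "S \<in> carrier_mat ?n ?n" "R \<in> carrier_mat ?n ?n"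
        "S * R = 1\<^sub>m ?n" "R * S = 1\<^sub>m ?n"
      and A'C': "A' \<in> psd_mats m" "C' \<in> psd_mats m"
      and P': "P' \<in> carrier_mat m m" "P' * A' = A'" "P' * C' = 0\<^sub>m m m"
      and A: "A = congr S (border (1\<^sub>m 1) A')" and C: "C = congr S (border (0\<^sub>m 1 1) C')"
      using ex_split_off_rank_one[OF Suc.prems False] by blast
    obtain U V r s where U: "U \<in> carrier_mat m m" "V \<in> carrier_mat m m" "U * V = 1\<^sub>m m" "V * U = 1\<^sub>m m"
      and rs: "r \<le> s" "s \<le> m"
      and A'U: "A' = congr U (id_block_mat m r)" and A'C'U: "A' + C' = congr U (id_block_mat m s)"
      using Suc.IH[OF A'C' P'] by blast
    have "A = congr (S * border (1\<^sub>m 1) U) (id_block_mat ?n (Suc r))"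
      using congr_border_id_block_mat[OF S(1) U(1), of r] rs by (simp add: A A'U)
    moreover have "A + C = congr (S * border (1\<^sub>m 1) U) (id_block_mat ?n (Suc s))"
    proof -
      have "A + C = congr S (border (1\<^sub>m 1) A' + border (0\<^sub>m 1 1) C')"
        unfolding A C using S psd_matsD(1)[OF A'C'(1)] psd_matsD(1)[OF A'C'(2)]
        by (intro congr_add[symmetric]) auto
      also have "border (1\<^sub>m 1) A' + border (0\<^sub>m 1 1) C' = border (1\<^sub>m 1) (A' + C')"
        using psd_matsD(1)[OF A'C'(1)] psd_matsD(1)[OF A'C'(2)] by (simp add: border_add[of _ _ m])
      finally show ?thesis
        using congr_border_id_block_mat[OF S(1) U(1) rs(2)] by (simp add: A'C'U)
    qed
    ultimately show ?thesis
      using mult_border_inverse[OF S U] rs by (metis Suc_le_mono)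
  qed
qed

section \<open>The minus order on positive semidefinite matrices\<close>

text \<open>
  With \<open>P = A X\<close> the equations \<open>A X A = A\<close> and \<open>X A = X B\<close> give \<open>P A = A = P B\<close>. Then
  \<open>Q = I - P\<close> satisfies \<open>Q B = B - A\<close>, and \<open>Q\<close> fixes \<open>B - A\<close>, which is Hermitian; hence
  \<open>B - A = Q B Q\<^sup>*\<close> inherits positivity from \<open>B\<close>.
\<close>

lemma minus_le_imp_ex_projection:
  fixes A B :: "'a :: conjugatable_ordered_field mat"
  assumes A: "A \<in> psd_mats n" and B: "B \<in> psd_mats n" and le: "A \<le>\<^sup>- B"
  shows "B - A \<in> psd_mats n \<and> (\<exists>P \<in> carrier_mat n n. P * A = A \<and> P * (B - A) = 0\<^sub>m n n)"
proof -
  note Ac = psd_matsD(1)[OF A] and Bc = psd_matsD(1)[OF B]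
  obtain X where X: "X \<in> carrier_mat n n" and AXA: "A * X * A = A" and XAB: "X * A = X * B"
    using le Ac unfolding minus_le_def inner_ginverse_def by (metis carrier_matD)
  define P where "P = A * X"
  define Q where "Q = 1\<^sub>m n - P"
  define C where "C = B - A"
  have P: "P \<in> carrier_mat n n" and Q: "Q \<in> carrier_mat n n" and C: "C \<in> carrier_mat n n"
    using Ac Bc X by (auto simp: P_def Q_def C_def)
  have PA: "P * A = A"
    by (simp add: P_def AXA)
  have "P * B = P * A"
    using assoc_mult_mat[OF Ac X Ac] assoc_mult_mat[OF Ac X Bc] by (simp add: P_def XAB)
  then have PC: "P * C = 0\<^sub>m n n"
    using mult_minus_distrib_mat[OF P Bc Ac] PA Ac by (simp add: C_def)
  have QM: "Q * M = M - P * M" if "M \<in> carrier_mat n n" for M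
    using minus_mult_distrib_mat[OF one_carrier_mat P that] that by (simp add: Q_def)
  have QB: "Q * B = C"
    unfolding QM[OF Bc] \<open>P * B = P * A\<close> PA C_def ..
  have QC: "Q * C = C"
    unfolding QM[OF C] PC by (rule eq_matI) (use C in auto)
  have Ca: "mat_adjoint C = C"
    using Ac Bc psd_matsD(2)[OF A] psd_matsD(2)[OF B] by (simp add: C_def mat_adjoint_minus)
  then have "C * mat_adjoint Q = C"
    using mat_adjoint_mult[OF Q C] QC by simp
  then have "congr Q B = C"
    by (simp add: congr_def QB)
  then have "C \<in> psd_mats n"
    using psd_mats_congr[OF B Q] by simp
  then show ?thesis
    using P PA PC by (auto simp: C_def)
qed

text \<open>
  The inner inverse \<open>R\<^sup>* D R\<close> with \<open>R = S\<^sup>-\<^sup>1\<close> and \<open>D = diag(I\<^sub>r, 0)\<close> works: in each product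
  the congruence cancels, and what remains is the multiplication of the diagonal block matrices.
\<close>

lemma minus_le_congr_id_block_mat:
  fixes S :: "'a :: conjugatable_field mat"
  assumes S: "S \<in> carrier_mat n n" and R: "R \<in> carrier_mat n n"
    and SR: "S * R = 1\<^sub>m n" and RS: "R * S = 1\<^sub>m n" and rs: "r \<le> s" "s \<le> n"
  shows "congr S (id_block_mat n r) \<le>\<^sup>- congr S (id_block_mat n s)"
proof -
  let ?D = "id_block_mat n :: nat \<Rightarrow> 'a mat"
  define X where "X = mat_adjoint R * ?D r * R"
  have Sa: "mat_adjoint S \<in> carrier_mat n n" and Ra: "mat_adjoint R \<in> carrier_mat n n"
    using S R by auto
  have SRa: "mat_adjoint S * mat_adjoint R = 1\<^sub>m n"
    using mat_adjoint_mult[OF R S] RS by simp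
  have D: "?D p \<in> carrier_mat n n" if "p \<le> n" for p
    using that by simp
  have r: "r \<le> n"
    using rs by simp
  note assoc = assoc_mult_mat[of _ n n _ n _ n] mult_carrier_mat[of _ n n _ n]
  have X: "X \<in> carrier_mat n n"
    using R Ra D[OF r] by (auto simp: X_def)
  have XM: "X * congr S (?D p) = mat_adjoint R * (?D r * ?D p) * mat_adjoint S" if p: "p \<le> n" for p
  proof -
    have "X * congr S (?D p) = mat_adjoint R * ?D r * (R * S) * ?D p * mat_adjoint S"
      unfolding X_def congr_def using S R Sa Ra D[OF r] D[OF p] by (simp add: assoc)
    then show ?thesis
      unfolding RS using S R Sa Ra D[OF r] D[OF p] by (simp add: assoc)
  qed
  have MX: "congr S (?D p) * X = S * (?D p * ?D r) * R" if p: "p \<le> n" for p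
  proof -
    have "congr S (?D p) * X = S * ?D p * (mat_adjoint S * mat_adjoint R) * ?D r * R"
      unfolding X_def congr_def using S R Sa Ra D[OF r] D[OF p] by (simp add: assoc)
    then show ?thesis
      unfolding SRa using S R Sa Ra D[OF r] D[OF p] by (simp add: assoc)
  qed
  have "congr S (?D r) * X * congr S (?D r) = S * ?D r * (R * S) * ?D r * mat_adjoint S"
    unfolding MX[OF r] id_block_mat_mult[OF order_refl r] unfolding congr_def
    using S R Sa D[OF r] by (simp add: assoc)
  also have "\<dots> = S * (?D r * ?D r) * mat_adjoint S"
    unfolding RS using S Sa D[OF r] by (simp add: assoc)
  also have "\<dots> = congr S (?D r)"
    by (simp add: congr_def id_block_mat_mult[OF order_refl r])
  finally have "congr S (?D r) * X * congr S (?D r) = congr S (?D r)" .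
  moreover have "X * congr S (?D r) = X * congr S (?D s)"
    by (simp only: XM[OF r] XM[OF rs(2)] id_block_mat_mult[OF rs] id_block_mat_mult[OF order_refl r])
  moreover have "congr S (?D r) * X = congr S (?D s) * X"
    by (simp only: MX[OF r] MX[OF rs(2)] id_block_mat_mult[OF rs] id_block_mat_mult[OF order_refl r])
  moreover have "congr S (?D r) \<in> carrier_mat n n" "congr S (?D s) \<in> carrier_mat n n"
    using S D r rs by auto
  ultimately show ?thesis
    unfolding minus_le_def inner_ginverse_def using X by (intro conjI exI[of _ X]) auto
qed

text \<open>
  The case distinction on \<open>A = B\<close> only sharpens \<open>r \<le> s\<close>: distinct matrices have distinct normal
  forms under the same \<open>S\<close>, and for equal ones the larger index can be used twice.
\<close>

theorem minus_le_iff_simultaneous_congr: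
  fixes A B :: "'a :: conjugatable_sqrt_field mat"
  assumes A: "A \<in> psd_mats n" and B: "B \<in> psd_mats n"
  shows "A \<le>\<^sup>- B \<longleftrightarrow>
    (\<exists>S \<in> carrier_mat n n. \<exists>r s. invertible_mat S \<and>
      A = S * id_block_mat n r * mat_adjoint S \<and>
      B = S * id_block_mat n s * mat_adjoint S \<and>
      s \<le> n \<and> (if A \<noteq> B then r < s else r = s))"
    (is "_ \<longleftrightarrow> ?rhs")
proof
  assume "A \<le>\<^sup>- B"
  from minus_le_imp_ex_projection[OF A B this]
  obtain P where C: "B - A \<in> psd_mats n" and P: "P \<in> carrier_mat n n" "P * A = A"
    "P * (B - A) = 0\<^sub>m n n"
    by blast
  obtain S R r s where S: "S \<in> carrier_mat n n" and R: "R \<in> carrier_mat n n"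
    and SR: "S * R = 1\<^sub>m n" "R * S = 1\<^sub>m n" and rs: "r \<le> s" "s \<le> n"
    and AS: "A = congr S (id_block_mat n r)" and ACS: "A + (B - A) = congr S (id_block_mat n s)"
    using psd_mats_simultaneous_congr[OF A C P] by blast
  have "A + (B - A) = B"
    by (rule eq_matI) (use psd_matsD(1)[OF A] psd_matsD(1)[OF B] in auto)
  with ACS have BS: "B = congr S (id_block_mat n s)"
    by simp
  have inv: "invertible_mat S"
    using S R SR unfolding invertible_mat_def inverts_mat_def by auto
  show ?rhs
  proof (cases "A = B")
    case True
    then show ?thesis
      using S inv rs BS unfolding congr_def by auto
  next
    case False
    then have "r < s"
      using AS BS rs by (metis le_neq_implies_less)
    then show ?thesis
      using False S inv rs AS BS unfolding congr_def by auto
  qed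
next
  assume ?rhs
  then obtain S r s where S: "S \<in> carrier_mat n n" and inv: "invertible_mat S"
    and AS: "A = congr S (id_block_mat n r)" and BS: "B = congr S (id_block_mat n s)"
    and rs: "r \<le> s" "s \<le> n"
    unfolding congr_def by (auto split: if_splits)
  from inv obtain R where "S * R = 1\<^sub>m (dim_row S)" "R * S = 1\<^sub>m (dim_row R)"
    unfolding invertible_mat_def inverts_mat_def by blast
  moreover from this have "R \<in> carrier_mat n n"
    using S by (metis carrier_matD carrier_matI index_mult_mat(2,3) index_one_mat(2,3))
  ultimately show "A \<le>\<^sup>- B"
    using minus_le_congr_id_block_mat[OF S _ _ _ rs] S AS BS by auto
qed

theorem theorem2:
  fixes n :: nat
  shows
    "(\<forall>A \<in> psd_mats n. \<forall>B \<in> psd_mats n. (A :: real mat) \<noteq> 0\<^sub>m n n \<longrightarrow>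
        (A \<le>\<^sup>- B \<longleftrightarrow>
          (\<exists>S \<in> carrier_mat n n. \<exists>r s. invertible_mat S \<and>
             A = S * id_block_mat n r * mat_adjoint S \<and>
             B = S * id_block_mat n s * mat_adjoint S \<and>
             s \<le> n \<and> (if A \<noteq> B then r < s else r = s)))) \<and>
     (\<forall>A \<in> psd_mats n. \<forall>B \<in> psd_mats n. (A :: complex mat) \<noteq> 0\<^sub>m n n \<longrightarrow>
        (A \<le>\<^sup>- B \<longleftrightarrow>
          (\<exists>S \<in> carrier_mat n n. \<exists>r s. invertible_mat S \<and>
             A = S * id_block_mat n r * mat_adjoint S \<and>
             B = S * id_block_mat n s * mat_adjoint S \<and>
             s \<le> n \<and> (if A \<noteq> B then r < s else r = s))))"
  by (intro conjI ballI impI minus_le_iff_simultaneous_congr)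

end
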